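(* If $\mathrm{st}$ is a weakly shuffle-compatible statistic on set partitions, then the shifted shuffle algebra $\mathcal{A}^{\Pi}_{\mathrm{st}}$ is a quotient algebra of $\mathrm{NCSym}^*$, i.e. isomorphic as a $\mathbb{Q}$-algebra to $\mathrm{NCSym}^*/I$ for some two-sided ideal $I$.
   Context: All algebras are over $\mathbb{Q}$. $\Pi_n$ is the set of set partitions of $[n]=\{1,\dots,n\}$ (unordered collections of nonempty pairwise disjoint blocks with union $[n]$), and $\Pi=\bigcup_{n\ge0}\Pi_n$; $|\pi|=n$ for $\pi\in\Pi_n$. For $\pi$ a set partition of $\{i_1<\dots<i_n\}$ and $S=\{s_1<\dots<s_n\}$, $\mathrm{shift}_S(\pi)$ is the set partition of $S$ obtained by replacing each $i_j$ by $s_j$. For $\tau\in\Pi_n,\theta\in\Pi_m$, the shifted arc-shuffle is the multiset (indexed by $S$) $\overrightarrow{\mathrm{ASh}}(\tau,\theta)=\{\{\mathrm{shift}_S(\tau)\cup\mathrm{shift}_{[n+m]\setminus S}(\theta): S\subseteq[n+m],|S|=n\}\}$. A statistic $\mathrm{st}$ on $\Pi$ is weakly shuffle-compatible on set partitions if for all $\tau,\theta\in\Pi$ the multiset $\{\{\mathrm{st}(\pi):\pi\in\overrightarrow{\mathrm{ASh}}(\tau,\theta)\}\}$ is determined by $\mathrm{st}(\tau),\mathrm{st}(\theta),|\tau|,|\theta|$. Let $[\pi]^\Pi_{\mathrm{st}}=\{\tau\in\Pi:\mathrm{st}(\tau)=\mathrm{st}(\pi),|\tau|=|\pi|\}$.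 $\mathcal{A}^\Pi_{\mathrm{st}}$ is the algebra with basis these classes and product $[\tau]^\Pi_{\mathrm{st}}[\theta]^\Pi_{\mathrm{st}}=\sum_{\pi\in\overrightarrow{\mathrm{ASh}}(\tau,\theta)}[\pi]^\Pi_{\mathrm{st}}$. $\mathrm{NCSym}^*$ is the algebra with basis $\{\mathbf{w}_\pi\}_{\pi\in\Pi}$ and product $\mathbf{w}_\tau\mathbf{w}_\theta=\sum_{\pi\in\overrightarrow{\mathrm{ASh}}(\tau,\theta)}\mathbf{w}_\pi$ (sums with multiplicity). *)

theory Defs
  imports
    Complex_Main
    "HOL-Library.Disjoint_Sets"
    "HOL-Library.Multiset"
    "HOL-Library.Poly_Mapping"
    "HOL-Algebra.QuotRing"
    "HOL-Algebra.Module"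
begin

type_synonym set_partition = "nat set set"

definition set_partitions_of :: "nat \<Rightarrow> set_partition set" where
  "set_partitions_of n = {\<pi>. partition_on {1..n} \<pi>}"

definition set_partitions :: "set_partition set" where
  "set_partitions = (\<Union>n. set_partitions_of n)"

definition psize :: "set_partition \<Rightarrow> nat" where
  "psize \<pi> = card (\<Union>\<pi>)"

text \<open>
  If \<open>\<Union>\<pi>\<close> is \<open>{i\<^sub>1 < \<dots> < i\<^sub>n}\<close>, then \<open>i\<^sub>j\<close> is the element \<open>x\<close> with exactly
  \<open>j - 1\<close> smaller elements in \<open>\<Union>\<pi>\<close>; list positions also start at 0, so it is sent to the
  \<open>j\<close>-th smallest element of \<open>S\<close>.
\<close>
definition shift :: "nat set \<Rightarrow> set_partition \<Rightarrow> set_partition" where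
  "shift S \<pi> =
     (\<lambda>B. (\<lambda>x. sorted_list_of_set S ! card {y \<in> \<Union>\<pi>. y < x}) ` B) ` \<pi>"

definition arc_shuffle :: "set_partition \<Rightarrow> set_partition \<Rightarrow> set_partition multiset" where
  "arc_shuffle \<tau> \<theta> =
     (let n = psize \<tau>; m = psize \<theta> in
       image_mset (\<lambda>S. shift S \<tau> \<union> shift ({1..n + m} - S) \<theta>)
         (mset_set {S. S \<subseteq> {1..n + m} \<and> card S = n}))"

text \<open>Only the values of a statistic on \<^const>\<open>set_partitions\<close> matter.\<close>

definition weakly_shuffle_compatible :: "(set_partition \<Rightarrow> 's) \<Rightarrow> bool" where
  "weakly_shuffle_compatible st \<longleftrightarrow>
     (\<forall>\<tau>\<in>set_partitions. \<forall>\<tau>'\<in>set_partitions.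
      \<forall>\<theta>\<in>set_partitions. \<forall>\<theta>'\<in>set_partitions.
        st \<tau> = st \<tau>' \<longrightarrow> st \<theta> = st \<theta>' \<longrightarrow> psize \<tau> = psize \<tau>' \<longrightarrow> psize \<theta> = psize \<theta>' \<longrightarrow>
        image_mset st (arc_shuffle \<tau> \<theta>) = image_mset st (arc_shuffle \<tau>' \<theta>'))"

definition st_class :: "(set_partition \<Rightarrow> 's) \<Rightarrow> set_partition \<Rightarrow> set_partition set" where
  "st_class st \<pi> = {\<tau> \<in> set_partitions. st \<tau> = st \<pi> \<and> psize \<tau> = psize \<pi>}"

text \<open>
  The \<open>\<rat>\<close>-vector space with basis \<open>B\<close> consists of the finitely supported functions with support
  in \<open>B\<close>, the basis vector of \<open>b\<close> being \<open>Poly_Mapping.single b 1\<close>. It carries the bilinear product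
  for which the product of the basis vectors of \<open>b\<close> and \<open>c\<close> is the sum (with multiplicity) of
  the basis vectors of the members of \<open>P b c\<close>, and the basis vector of \<open>e\<close> as unit.
\<close>
definition basis_algebra ::
  "'b set \<Rightarrow> 'b \<Rightarrow> ('b \<Rightarrow> 'b \<Rightarrow> 'b multiset) \<Rightarrow> (rat, 'b \<Rightarrow>\<^sub>0 rat) module" where
  "basis_algebra B e P =
     \<lparr>carrier = {f. Poly_Mapping.keys f \<subseteq> B},
      mult = (\<lambda>f g. \<Sum>b\<in>Poly_Mapping.keys f. \<Sum>c\<in>Poly_Mapping.keys g. \<Sum>d\<in>#P b c.
        Poly_Mapping.single d (Poly_Mapping.lookup f b * Poly_Mapping.lookup g c)),
      one = Poly_Mapping.single e 1,
      zero = 0,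
      add = (+),
      smult = (\<lambda>q. Poly_Mapping.map ((*) q))\<rparr>"

text \<open>
  The quotient ring by a two-sided ideal, with \<open>q \<odot> (I + x) = I + q \<odot> x\<close>; the union makes this
  a function of the coset, as in \<^const>\<open>rcoset_mult\<close>.
\<close>
definition quotient_algebra ::
  "('r, 'a, 'm) module_scheme \<Rightarrow> 'a set \<Rightarrow> ('r, 'a set) module" where
  "quotient_algebra A I =
     \<lparr>carrier = carrier (A Quot I),
      mult = mult (A Quot I),
      one = one (A Quot I),
      zero = zero (A Quot I),
      add = add (A Quot I),
      smult = (\<lambda>q X. \<Union>x\<in>X. I +>\<^bsub>A\<^esub> (q \<odot>\<^bsub>A\<^esub> x))\<rparr>"

definition algebra_iso ::
  "('r, 'a, 'm) module_scheme \<Rightarrow> ('r, 'b, 'n) module_scheme \<Rightarrow> ('a \<Rightarrow> 'b) set" where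
  "algebra_iso A B =
     {h \<in> ring_iso A B. \<forall>q. \<forall>x\<in>carrier A. h (q \<odot>\<^bsub>A\<^esub> x) = q \<odot>\<^bsub>B\<^esub> h x}"

definition NCSym_dual :: "(rat, set_partition \<Rightarrow>\<^sub>0 rat) module" where
  "NCSym_dual = basis_algebra set_partitions {} arc_shuffle"

text \<open>
  The product of two classes is computed from chosen representatives;
  \<open>shuffle_algebra_mult_st_class\<close> below shows that for weakly shuffle-compatible statistics
  every choice gives the same result.
\<close>
definition shuffle_algebra ::
  "(set_partition \<Rightarrow> 's) \<Rightarrow> (rat, set_partition set \<Rightarrow>\<^sub>0 rat) module" where
  "shuffle_algebra st =
     basis_algebra (st_class st ` set_partitions) (st_class st {})
       (\<lambda>C D. image_mset (st_class st) (arc_shuffle (SOME \<tau>. \<tau> \<in> C) (SOME \<theta>. \<theta> \<in> D)))"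

lemma psize_set_partitions_of: "\<pi> \<in> set_partitions_of n \<Longrightarrow> psize \<pi> = n"
  by (auto simp: set_partitions_of_def psize_def partition_on_def)

lemma Union_shift:
  assumes "\<pi> \<in> set_partitions_of n" "finite S" "card S = n"
  shows "\<Union>(shift S \<pi>) = S"
proof -
  have U: "\<Union>\<pi> = {1..n}" using assms(1) by (auto simp: set_partitions_of_def partition_on_def)
  have c: "card {y \<in> {1..n}. y < x} = x - 1" if "x \<in> {1..n}" for x
  proof -
    have "{y \<in> {1..n}. y < x} = {1..<x}" using that by auto
    then show ?thesis by simp
  qed
  have "\<Union>(shift S \<pi>) = (\<lambda>x. sorted_list_of_set S ! card {y \<in> {1..n}. y < x}) ` {1..n}"
    unfolding shift_def U[symmetric] by blast
  also have "\<dots> = (\<lambda>x. sorted_list_of_set S ! (x - 1)) ` {1..n}"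
    using c by (intro image_cong) auto
  also have "\<dots> = (\<lambda>i. sorted_list_of_set S ! i) ` ((\<lambda>x. x - 1) ` {1..n})"
    by (simp add: image_image)
  also have "(\<lambda>x. x - 1) ` {1..n} = {..<n}"
  proof -
    have "i \<in> (\<lambda>x. x - 1) ` {1..n}" if "i < n" for i
      using that by (intro image_eqI[of _ _ "Suc i"]) auto
    then show ?thesis by auto
  qed
  also have "(\<lambda>i. sorted_list_of_set S ! i) ` {..<n} = set (sorted_list_of_set S)"
    using assms by (auto simp: set_conv_nth)
  finally show ?thesis using assms(2) by simp
qed

lemma psize_arc_shuffle:
  assumes "\<tau> \<in> set_partitions" "\<theta> \<in> set_partitions" "\<pi> \<in># arc_shuffle \<tau> \<theta>"
  shows "psize \<pi> = psize \<tau> + psize \<theta>"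
proof -
  obtain n m where nm: "\<tau> \<in> set_partitions_of n" "\<theta> \<in> set_partitions_of m"
    using assms by (auto simp: set_partitions_def)
  have "finite {S. S \<subseteq> {1..n + m} \<and> card S = n}"
    by (rule finite_subset[of _ "Pow {1..n + m}"]) auto
  with assms(3) obtain S where S: "S \<subseteq> {1..n + m}" "card S = n"
    "\<pi> = shift S \<tau> \<union> shift ({1..n + m} - S) \<theta>"
    by (auto simp: arc_shuffle_def psize_set_partitions_of[OF nm(1)]
        psize_set_partitions_of[OF nm(2)])
  have f: "finite S" using S(1) finite_subset by blast
  have "card ({1..n + m} - S) = m" using S f by (simp add: card_Diff_subset)
  then have "\<Union>\<pi> = S \<union> ({1..n + m} - S)"
    using Union_shift[OF nm(1) f S(2)] Union_shift[OF nm(2)] S(3) by simp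
  then have "\<Union>\<pi> = {1..n + m}" using S(1) by auto
  then show ?thesis using nm by (simp add: psize_def[of \<pi>] psize_set_partitions_of)
qed

lemma image_st_class_arc_shuffle_cong:
  assumes st: "weakly_shuffle_compatible st"
    and P: "\<tau> \<in> set_partitions" "\<theta> \<in> set_partitions"
    and C: "\<tau>' \<in> st_class st \<tau>" "\<theta>' \<in> st_class st \<theta>"
  shows "image_mset (st_class st) (arc_shuffle \<tau>' \<theta>') =
    image_mset (st_class st) (arc_shuffle \<tau> \<theta>)"
proof -
  define N where "N = psize \<tau> + psize \<theta>"
  define F where "F s = {\<rho> \<in> set_partitions. st \<rho> = s \<and> psize \<rho> = N}" for s
  have C': "\<tau>' \<in> set_partitions" "\<theta>' \<in> set_partitions" "st \<tau>' = st \<tau>" "st \<theta>' = st \<theta>"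
    "psize \<tau>' = psize \<tau>" "psize \<theta>' = psize \<theta>"
    using C by (auto simp: st_class_def)
  have cls: "image_mset (st_class st) (arc_shuffle a b) = image_mset F (image_mset st (arc_shuffle a b))"
    if "a \<in> set_partitions" "b \<in> set_partitions" "psize a + psize b = N" for a b
    unfolding image_mset.compositionality
    by (rule image_mset_cong)
      (use psize_arc_shuffle[OF that(1,2)] that(3) in \<open>auto simp: st_class_def F_def\<close>)
  have "image_mset st (arc_shuffle \<tau>' \<theta>') = image_mset st (arc_shuffle \<tau> \<theta>)"
    using st P C' unfolding weakly_shuffle_compatible_def by blast
  then show ?thesis using cls[OF P] cls[OF C'(1,2)] C' by (simp add: N_def)
qed

lemma shuffle_algebra_mult_st_class:
  assumes "weakly_shuffle_compatible st" "\<tau> \<in> set_partitions" "\<theta> \<in> set_partitions"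
  shows "Poly_Mapping.single (st_class st \<tau>) 1 \<otimes>\<^bsub>shuffle_algebra st\<^esub>
      Poly_Mapping.single (st_class st \<theta>) 1 =
    (\<Sum>\<pi>\<in>#arc_shuffle \<tau> \<theta>. Poly_Mapping.single (st_class st \<pi>) 1)"
proof -
  have some: "(SOME x. x \<in> st_class st \<rho>) \<in> st_class st \<rho>" if "\<rho> \<in> set_partitions" for \<rho>
    using that by (intro someI[of "\<lambda>x. x \<in> st_class st \<rho>" \<rho>]) (simp add: st_class_def)
  let ?C = "st_class st"
  have "Poly_Mapping.single (?C \<tau>) 1 \<otimes>\<^bsub>shuffle_algebra st\<^esub> Poly_Mapping.single (?C \<theta>) 1 =
      (\<Sum>d\<in>#image_mset ?C (arc_shuffle (SOME x. x \<in> ?C \<tau>) (SOME x. x \<in> ?C \<theta>)).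
        Poly_Mapping.single d 1)"
    by (simp add: shuffle_algebra_def basis_algebra_def)
  also have "image_mset ?C (arc_shuffle (SOME x. x \<in> ?C \<tau>) (SOME x. x \<in> ?C \<theta>)) =
      image_mset ?C (arc_shuffle \<tau> \<theta>)"
    by (rule image_st_class_arc_shuffle_cong[OF assms some[OF assms(2)] some[OF assms(3)]])
  finally show ?thesis
    by (simp add: image_mset.compositionality comp_def)
qed

lemma NCSym_dual_mult_basis:
  "Poly_Mapping.single \<tau> 1 \<otimes>\<^bsub>NCSym_dual\<^esub> Poly_Mapping.single \<theta> 1 =
    (\<Sum>\<pi>\<in>#arc_shuffle \<tau> \<theta>. Poly_Mapping.single \<pi> 1)"
  by (simp add: NCSym_dual_def basis_algebra_def)

end

theory Submission
  imports Defs
begin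

text \<open>
  The classes inherit their structure constants from those of set partitions, so sending
  \<open>w\<^sub>\<pi>\<close> to the class of \<open>\<pi>\<close> extends to a surjective algebra
  homomorphism, and \<open>I\<close> is its kernel. Associativity of \<open>NCSym\<^sup>*\<close> holds because both
  ways of shuffling \<open>\<tau>\<close>, \<open>\<theta>\<close>, \<open>\<rho>\<close> run over the ordered decompositions of
  \<open>[n + m + k]\<close> into sets \<open>A\<close>, \<open>B\<close>, \<open>C\<close> of sizes \<open>n\<close>, \<open>m\<close>, \<open>k\<close>, each
  contributing the union of the three partitions shifted to \<open>A\<close>, \<open>B\<close>, \<open>C\<close>.
\<close>

subsection \<open>Linear extension and structure constants\<close>

abbreviation scale :: "rat \<Rightarrow> ('b \<Rightarrow>\<^sub>0 rat) \<Rightarrow> ('b \<Rightarrow>\<^sub>0 rat)" where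
  "scale q \<equiv> Poly_Mapping.map ((*) q)"

lemma lookup_scale: "Poly_Mapping.lookup (scale q f) k = q * Poly_Mapping.lookup f k"
  by transfer (simp add: when_def)

lemma scale_zero_right: "scale q 0 = 0"
  by (rule poly_mapping_eqI) (simp add: lookup_scale)

lemma scale_add_right: "scale q (f + g) = scale q f + scale q g"
  by (rule poly_mapping_eqI) (simp add: lookup_scale lookup_add algebra_simps)

text \<open>The linear map determined by its values \<open>F b\<close> on basis vectors. Nesting two
  of them gives a bilinear extension, which is how products are treated below.\<close>

definition lext :: "('b \<Rightarrow> 'c \<Rightarrow>\<^sub>0 rat) \<Rightarrow> ('b \<Rightarrow>\<^sub>0 rat) \<Rightarrow> ('c \<Rightarrow>\<^sub>0 rat)" where
  "lext F f = (\<Sum>b\<in>Poly_Mapping.keys f. scale (Poly_Mapping.lookup f b) (F b))"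

text \<open>Coefficients vanish off the support, so any finite superset may index the sum. This puts
  vectors with different supports over one common index set.\<close>

lemma lookup_lext_superset:
  assumes "finite X" "Poly_Mapping.keys f \<subseteq> X"
  shows "Poly_Mapping.lookup (lext F f) c =
    (\<Sum>b\<in>X. Poly_Mapping.lookup f b * Poly_Mapping.lookup (F b) c)"
proof -
  have "Poly_Mapping.lookup (lext F f) c =
      (\<Sum>b\<in>Poly_Mapping.keys f. Poly_Mapping.lookup f b * Poly_Mapping.lookup (F b) c)"
    by (simp add: lext_def lookup_sum lookup_scale)
  also have "\<dots> = (\<Sum>b\<in>X. Poly_Mapping.lookup f b * Poly_Mapping.lookup (F b) c)"
    using assms by (intro sum.mono_neutral_left) (auto simp: in_keys_iff)
  finally show ?thesis .
qed

lemmas lookup_lext = lookup_lext_superset[OF finite_keys order_refl]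

lemma lext_zero: "lext F 0 = 0"
  by (simp add: lext_def)

lemma lext_add: "lext F (f + g) = lext F f + lext F g"
proof (rule poly_mapping_eqI)
  fix c
  let ?X = "Poly_Mapping.keys f \<union> Poly_Mapping.keys g"
  show "Poly_Mapping.lookup (lext F (f + g)) c = Poly_Mapping.lookup (lext F f + lext F g) c"
    using lookup_lext_superset[of ?X "f + g" F c] lookup_lext_superset[of ?X f F c]
      lookup_lext_superset[of ?X g F c] keys_add[of f g]
    by (simp add: lookup_add algebra_simps sum.distrib)
qed

lemma lext_add_fun: "lext (\<lambda>b. F b + G b) f = lext F f + lext G f"
  by (rule poly_mapping_eqI) (simp add: lookup_lext lookup_add algebra_simps sum.distrib)

lemma keys_scale: "Poly_Mapping.keys (scale q f) \<subseteq> Poly_Mapping.keys f"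
  by (auto simp: in_keys_iff lookup_scale)

lemma lext_scale: "lext F (scale q f) = scale q (lext F f)"
proof (rule poly_mapping_eqI)
  fix c
  show "Poly_Mapping.lookup (lext F (scale q f)) c = Poly_Mapping.lookup (scale q (lext F f)) c"
    using lookup_lext_superset[OF finite_keys keys_scale, of F q f c]
    by (simp add: lookup_lext[of F f] lookup_scale sum_distrib_left mult.assoc)
qed

lemma lext_single: "lext F (Poly_Mapping.single b q) = scale q (F b)"
  by (rule poly_mapping_eqI)
    (simp add: lookup_lext_superset[of "{b}"] lookup_scale)

lemma one_scale: "scale 1 f = f"
  by (rule poly_mapping_eqI) (simp add: lookup_scale)

lemma lext_sum: "lext F (\<Sum>i\<in>X. f i) = (\<Sum>i\<in>X. lext F (f i))"
  by (induction X rule: infinite_finite_induct) (simp_all add: lext_zero lext_add)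

lemma lext_sum_mset: "lext F (\<Sum>i\<in>#X. f i) = (\<Sum>i\<in>#X. lext F (f i))"
  by (induction X) (simp_all add: lext_zero lext_add)

text \<open>By linearity the composite of two linear extensions is again determined by its values on
  basis vectors.\<close>

lemma lext_lext: "lext G (lext F f) = lext (\<lambda>b. lext G (F b)) f"
  by (simp add: lext_def[of F] lext_def[of "\<lambda>b. lext G (F b)"] lext_sum lext_scale)

lemma lext_cong:
  "(\<And>b. b \<in> Poly_Mapping.keys f \<Longrightarrow> F b = G b) \<Longrightarrow> lext F f = lext G f"
  by (simp add: lext_def)

lemma lext_basis: "lext (\<lambda>b. Poly_Mapping.single b 1) f = f"
proof (rule poly_mapping_eqI)
  fix c
  show "Poly_Mapping.lookup (lext (\<lambda>b. Poly_Mapping.single b 1) f) c = Poly_Mapping.lookup f c"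
    \<comment> \<open>With \<open>c\<close> adjoined to the index set, the sum collapses to its term
      at \<open>c\<close> whether or not \<open>c\<close> lies in the support.\<close>
    by (subst lookup_lext_superset[of "insert c (Poly_Mapping.keys f)"])
      (auto simp: lookup_single when_def if_distrib[of "(*) _"] in_keys_iff cong: if_cong)
qed

text \<open>Exchange of two finite sums: a bilinear extension may be evaluated in either argument
  first.\<close>

lemma lext_swap: "lext (\<lambda>b. lext (F b) g) f = lext (\<lambda>c. lext (\<lambda>b. F b c) f) g"
  by (rule poly_mapping_eqI, simp add: lookup_lext sum_distrib_left)
    (subst sum.swap, simp add: mult.left_commute)

lemma keys_lext:
  assumes "\<And>b. b \<in> Poly_Mapping.keys f \<Longrightarrow> Poly_Mapping.keys (F b) \<subseteq> C"
  shows "Poly_Mapping.keys (lext F f) \<subseteq> C"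
proof
  fix c assume "c \<in> Poly_Mapping.keys (lext F f)"
  then have "(\<Sum>b\<in>Poly_Mapping.keys f. Poly_Mapping.lookup f b * Poly_Mapping.lookup (F b) c) \<noteq> 0"
    by (simp add: in_keys_iff lookup_lext)
  then obtain b where "b \<in> Poly_Mapping.keys f" "Poly_Mapping.lookup (F b) c \<noteq> 0"
    by (metis (no_types, lifting) mult_zero_right sum.neutral)
  then show "c \<in> C" using assms by (meson in_keys_iff subsetD)
qed

section \<open>Vectors of multisets and the product as a bilinear extension\<close>

text \<open>Multiplicities become coefficients, so identities between multisets turn into identities
  between vectors.\<close>

definition bsum :: "'b multiset \<Rightarrow> 'b \<Rightarrow>\<^sub>0 rat" where
  "bsum A = (\<Sum>d\<in>#A. Poly_Mapping.single d 1)"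

lemma bsum_simps [simp]: "bsum {#} = 0" "bsum (add_mset a A) = Poly_Mapping.single a 1 + bsum A"
  by (simp_all add: bsum_def)

lemma bsum_union: "bsum (A + B) = bsum A + bsum B"
  by (simp add: bsum_def)

lemma bsum_sum_mset: "bsum (\<Sum>d\<in>#A. F d) = (\<Sum>d\<in>#A. bsum (F d))"
  by (induction A) (simp_all add: bsum_union)

lemma lext_bsum: "lext F (bsum A) = (\<Sum>d\<in>#A. F d)"
  by (simp add: bsum_def lext_sum_mset lext_single one_scale)

lemma keys_bsum: "Poly_Mapping.keys (bsum A) \<subseteq> set_mset A"
proof (induction A)
  case (add a A)
  then show ?case
    using keys_add[of "Poly_Mapping.single a (1::rat)" "bsum A"] by auto
qed simp

text \<open>The double sum defining the product is the bilinear extension of the structure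
  constants; everything about products is then linear algebra with \<open>lext\<close>.\<close>

lemma mult_basis_algebra:
  "f \<otimes>\<^bsub>basis_algebra B e P\<^esub> g = lext (\<lambda>b. lext (\<lambda>c. bsum (P b c)) g) f"
proof -
  have s: "scale q (bsum A) = (\<Sum>d\<in>#A. Poly_Mapping.single d q)" for q and A :: "'a multiset"
    by (induction A) (simp_all add: scale_zero_right scale_add_right)
  have m: "scale q (lext F g) = (\<Sum>c\<in>Poly_Mapping.keys g. scale (q * Poly_Mapping.lookup g c) (F c))"
    for q and F :: "'a \<Rightarrow> 'a \<Rightarrow>\<^sub>0 rat"
    by (rule poly_mapping_eqI)
      (simp add: lookup_scale lookup_lext lookup_sum sum_distrib_left mult.assoc)
  show ?thesis
    unfolding lext_def[of _ f] by (simp only: m s) (simp add: basis_algebra_def)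
qed

section \<open>Rings from multiset-valued monoids\<close>

text \<open>The closure, unit and associativity laws of the product, read off on basis elements.
  They are confined to \<open>B\<close> because \<open>P\<close> may be arbitrary outside
  it.\<close>

locale basis_monoid =
  fixes B :: "'b set" and e :: 'b and P :: "'b \<Rightarrow> 'b \<Rightarrow> 'b multiset"
  assumes unit_closed: "e \<in> B"
    and mult_closed: "a \<in> B \<Longrightarrow> b \<in> B \<Longrightarrow> set_mset (P a b) \<subseteq> B"
    and unit_left: "a \<in> B \<Longrightarrow> P e a = {#a#}"
    and unit_right: "a \<in> B \<Longrightarrow> P a e = {#a#}"
    and assoc: "a \<in> B \<Longrightarrow> b \<in> B \<Longrightarrow> c \<in> B \<Longrightarrow>
      (\<Sum>d\<in>#P a b. P d c) = (\<Sum>d\<in>#P b c. P a d)"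
begin

text \<open>Associativity and the unit laws are multilinear, so it suffices to check them on basis
  vectors, where they are the locale assumptions; distributivity is additivity of
  \<open>lext\<close>.\<close>

lemma ring_basis_algebra: "ring (basis_algebra B e P)"
proof (rule ringI)
  let ?A = "basis_algebra B e P"
  have carr: "x \<in> carrier ?A \<longleftrightarrow> Poly_Mapping.keys x \<subseteq> B" for x
    by (simp add: basis_algebra_def)
  have ops: "x \<oplus>\<^bsub>?A\<^esub> y = x + y" "\<zero>\<^bsub>?A\<^esub> = 0" "\<one>\<^bsub>?A\<^esub> = Poly_Mapping.single e 1" for x y
    by (simp_all add: basis_algebra_def)
  show "abelian_group ?A"
  proof (rule abelian_groupI)
    fix x assume "x \<in> carrier ?A"
    then show "\<exists>y\<in>carrier ?A. y \<oplus>\<^bsub>?A\<^esub> x = \<zero>\<^bsub>?A\<^esub>"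
      by (intro bexI[of _ "- x"]) (auto simp: ops carr in_keys_iff)
  qed (use keys_add in \<open>fastforce simp: carr ops algebra_simps\<close>)+
  show "monoid ?A"
  proof (rule monoidI)
    fix x y assume "x \<in> carrier ?A" "y \<in> carrier ?A"
    then show "x \<otimes>\<^bsub>?A\<^esub> y \<in> carrier ?A"
      unfolding carr mult_basis_algebra
      by (intro keys_lext order_trans[OF keys_bsum] mult_closed) auto
  next
    show "\<one>\<^bsub>?A\<^esub> \<in> carrier ?A"
      by (simp add: carr ops unit_closed)
  next
    fix x y z assume "x \<in> carrier ?A" "y \<in> carrier ?A" "z \<in> carrier ?A"
    then have k: "Poly_Mapping.keys x \<subseteq> B" "Poly_Mapping.keys y \<subseteq> B" "Poly_Mapping.keys z \<subseteq> B"
      by (simp_all add: carr)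
    \<comment> \<open>Exchanging the extension over \<open>z\<close> with the one over the members
      \<open>d\<close> of \<open>P a b\<close> exhibits the product as a trilinear extension, to be
      compared with the other bracketing on basis triples.\<close>
    have "(x \<otimes>\<^bsub>?A\<^esub> y) \<otimes>\<^bsub>?A\<^esub> z =
        lext (\<lambda>a. lext (\<lambda>b. lext (\<lambda>c. lext (\<lambda>d. bsum (P d c)) (bsum (P a b))) z) y) x"
      by (simp add: mult_basis_algebra lext_lext lext_swap[where g = z])
    also have "\<dots> = lext (\<lambda>a. lext (\<lambda>b. lext (\<lambda>c. lext (\<lambda>d. bsum (P a d)) (bsum (P b c))) z) y) x"
    proof (intro lext_cong)
      fix a b c assume "a \<in> Poly_Mapping.keys x" "b \<in> Poly_Mapping.keys y" "c \<in> Poly_Mapping.keys z"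
      then have "(\<Sum>d\<in>#P a b. P d c) = (\<Sum>d\<in>#P b c. P a d)"
        using k by (intro assoc) auto
      then show "lext (\<lambda>d. bsum (P d c)) (bsum (P a b)) = lext (\<lambda>d. bsum (P a d)) (bsum (P b c))"
        unfolding lext_bsum by (simp flip: bsum_sum_mset)
    qed
    also have "\<dots> = x \<otimes>\<^bsub>?A\<^esub> (y \<otimes>\<^bsub>?A\<^esub> z)"
      by (simp add: mult_basis_algebra lext_lext)
    finally show "(x \<otimes>\<^bsub>?A\<^esub> y) \<otimes>\<^bsub>?A\<^esub> z = x \<otimes>\<^bsub>?A\<^esub> (y \<otimes>\<^bsub>?A\<^esub> z)" .
  next
    fix x assume "x \<in> carrier ?A"
    then have k: "Poly_Mapping.keys x \<subseteq> B" by (simp add: carr)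
    have "\<one>\<^bsub>?A\<^esub> \<otimes>\<^bsub>?A\<^esub> x = lext (\<lambda>b. Poly_Mapping.single b 1) x"
      using k by (auto simp: ops mult_basis_algebra lext_single one_scale unit_left intro!: lext_cong)
    then show "\<one>\<^bsub>?A\<^esub> \<otimes>\<^bsub>?A\<^esub> x = x" by (simp add: lext_basis)
    have "x \<otimes>\<^bsub>?A\<^esub> \<one>\<^bsub>?A\<^esub> = lext (\<lambda>b. Poly_Mapping.single b 1) x"
      using k by (auto simp: ops mult_basis_algebra lext_single one_scale unit_right intro!: lext_cong)
    then show "x \<otimes>\<^bsub>?A\<^esub> \<one>\<^bsub>?A\<^esub> = x" by (simp add: lext_basis)
  qed
\<comment> \<open>What remains is distributivity. Products are turned into \<open>lext\<close>
  before the record is unfolded, since unfolding first would expose the raw double sum.\<close>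
qed (simp_all add: mult_basis_algebra lext_add lext_add_fun, simp_all add: basis_algebra_def lext_add lext_add_fun)

end

section \<open>Quotients induced by maps of bases\<close>

text \<open>A map of bases that respects structure constants extends linearly to a surjective
  algebra homomorphism, and the first isomorphism theorem applies. The condition on
  \<open>P'\<close> says that products in the image may be computed from any
  representatives.\<close>

lemma basis_algebra_quotient:
  fixes q :: "'a \<Rightarrow> 'b"
  assumes A: "basis_monoid A e P"
    and P': "\<And>a b. a \<in> A \<Longrightarrow> b \<in> A \<Longrightarrow> P' (q a) (q b) = image_mset q (P a b)"
  defines "R \<equiv> basis_algebra A e P" and "S \<equiv> basis_algebra (q ` A) (q e) P'"
  shows "\<exists>I. ideal I R \<and> (\<exists>h. h \<in> algebra_iso (quotient_algebra R I) S)"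
proof -
  interpret A: basis_monoid A e P by (rule A)
  \<comment> \<open>Every element of the image has a representative in \<open>A\<close>, and
    \<open>P'\<close> commutes with \<open>q\<close>, so the laws of \<open>P\<close> descend to
    \<open>P'\<close>.\<close>
  interpret Q: basis_monoid "q ` A" "q e" P'
  proof
    show "q e \<in> q ` A" using A.unit_closed by blast
  next
    fix a b assume "a \<in> q ` A" "b \<in> q ` A"
    then show "set_mset (P' a b) \<subseteq> q ` A"
      using A.mult_closed by (fastforce simp: P')
  next
    fix a assume "a \<in> q ` A"
    then show "P' (q e) a = {#a#}" "P' a (q e) = {#a#}"
      by (auto simp: P' A.unit_closed A.unit_left A.unit_right)
  next
    fix a b c assume "a \<in> q ` A" "b \<in> q ` A" "c \<in> q ` A"
    then obtain x y z where x: "x \<in> A" "y \<in> A" "z \<in> A" "a = q x" "b = q y" "c = q z" by blast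
    have im: "image_mset q (\<Sum>d\<in>#X. F d) = (\<Sum>d\<in>#X. image_mset q (F d))"
      for X :: "'a multiset" and F by (induction X) simp_all
    have "(\<Sum>d\<in>#P' a b. P' d c) = (\<Sum>d\<in>#P x y. P' (q d) (q z))"
      by (simp add: x P' image_mset.compositionality comp_def)
    \<comment> \<open>Closure of \<open>A\<close> under \<open>P\<close> keeps every
      \<open>d\<close> inside \<open>A\<close>, where the condition on \<open>P'\<close>
      applies.\<close>
    also have "\<dots> = (\<Sum>d\<in>#P x y. image_mset q (P d z))"
      using x A.mult_closed[of x y]
      by (intro arg_cong[where f = sum_mset] image_mset_cong P') auto
    also have "\<dots> = (\<Sum>d\<in>#P y z. image_mset q (P x d))"
      using A.assoc[OF x(1-3)] by (simp flip: im)
    also have "\<dots> = (\<Sum>d\<in>#P y z. P' (q x) (q d))"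
      using x A.mult_closed[of y z]
      by (intro arg_cong[where f = sum_mset] image_mset_cong P'[symmetric]) auto
    also have "\<dots> = (\<Sum>d\<in>#P' b c. P' a d)"
      by (simp add: x P' image_mset.compositionality comp_def)
    finally show "(\<Sum>d\<in>#P' a b. P' d c) = (\<Sum>d\<in>#P' b c. P' a d)" .
  qed
  define \<phi> where "\<phi> = lext (\<lambda>a. Poly_Mapping.single (q a) 1)"
  have carr: "x \<in> carrier R \<longleftrightarrow> Poly_Mapping.keys x \<subseteq> A" "y \<in> carrier S \<longleftrightarrow> Poly_Mapping.keys y \<subseteq> q ` A"
    for x y by (simp_all add: R_def S_def basis_algebra_def)
  have smult: "r \<odot>\<^bsub>R\<^esub> x = scale r x" "r \<odot>\<^bsub>S\<^esub> y = scale r y" for r x y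
    by (simp_all add: R_def S_def basis_algebra_def)
  have bs: "\<phi> (bsum X) = bsum (image_mset q X)" for X
    unfolding \<phi>_def lext_bsum by (simp add: bsum_def image_mset.compositionality comp_def)
  have closed: "\<phi> x \<in> carrier S" if "x \<in> carrier R" for x
    using that unfolding carr \<phi>_def by (intro keys_lext) auto
  interpret \<phi>: ring_hom_ring R S \<phi>
  proof (rule ring_hom_ringI)
    show "ring R" "ring S"
      unfolding R_def S_def by (rule A.ring_basis_algebra Q.ring_basis_algebra)+
    show "\<phi> (x \<otimes>\<^bsub>R\<^esub> y) = \<phi> x \<otimes>\<^bsub>S\<^esub> \<phi> y" if "x \<in> carrier R" "y \<in> carrier R" for x y
    proof -
      \<comment> \<open>Both sides are bilinear in \<open>x\<close> and \<open>y\<close>; on a pair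
        of basis vectors the equality is the condition on \<open>P'\<close>.\<close>
      have "\<phi> (x \<otimes>\<^bsub>R\<^esub> y) = lext (\<lambda>a. lext (\<lambda>b. \<phi> (bsum (P a b))) y) x"
        by (simp add: R_def mult_basis_algebra \<phi>_def lext_lext)
      also have "\<dots> = lext (\<lambda>a. lext (\<lambda>b. bsum (P' (q a) (q b))) y) x"
        using that unfolding carr 
        by (intro lext_cong) (simp only: bs P' subsetD)
      also have "\<dots> = \<phi> x \<otimes>\<^bsub>S\<^esub> \<phi> y"
        by (simp add: S_def mult_basis_algebra \<phi>_def lext_lext lext_single one_scale)
      finally show ?thesis .
    qed
    show "\<phi> (x \<oplus>\<^bsub>R\<^esub> y) = \<phi> x \<oplus>\<^bsub>S\<^esub> \<phi> y" for x y
      by (simp add: R_def S_def basis_algebra_def \<phi>_def lext_add)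
    show "\<phi> \<one>\<^bsub>R\<^esub> = \<one>\<^bsub>S\<^esub>"
      by (simp add: R_def S_def basis_algebra_def \<phi>_def lext_single)
  qed (rule closed)
  have "\<phi> ` carrier R = carrier S"
  proof
    show "\<phi> ` carrier R \<subseteq> carrier S" using closed by blast
    show "carrier S \<subseteq> \<phi> ` carrier R"
    proof
      fix y assume y: "y \<in> carrier S"
      \<comment> \<open>A preimage of \<open>y\<close>: each basis element of the image is replaced
        by a chosen representative in \<open>A\<close>.\<close>
      define x where "x = lext (\<lambda>b. Poly_Mapping.single (inv_into A q b) 1) y"
      have "x \<in> carrier R"
        using y unfolding carr x_def by (intro keys_lext) (auto intro: inv_into_into)
      moreover have "\<phi> x = lext (\<lambda>b. Poly_Mapping.single b 1) y"
        using y unfolding carr \<phi>_def x_def lext_lext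
        by (intro lext_cong) (auto simp: lext_single f_inv_into_f)
      ultimately show "y \<in> \<phi> ` carrier R" by (auto simp: lext_basis)
    qed
  qed
  define I where "I = a_kernel R S \<phi>"
  \<comment> \<open>The value that \<phi> takes on all of a coset of its kernel. The library theorem
    makes this a ring isomorphism, so only scalars remain to be checked.\<close>
  define h where "h = (\<lambda>X. the_elem (\<phi> ` X))"
  have hom: "h \<in> ring_iso (R Quot I) S"
    unfolding h_def I_def by (rule \<phi>.FactRing_iso_set) fact
  have "h (r \<odot>\<^bsub>quotient_algebra R I\<^esub> X) = r \<odot>\<^bsub>S\<^esub> h X"
    if X: "X \<in> carrier (quotient_algebra R I)" for r X
  proof -
    obtain x where x: "x \<in> carrier R" "X = I +>\<^bsub>R\<^esub> x"
      using X by (auto simp: quotient_algebra_def FactRing_def A_RCOSETS_def')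
    have coset: "\<phi> y = \<phi> z" if "y \<in> I +>\<^bsub>R\<^esub> z" "z \<in> carrier R" for y z
      using \<phi>.rcos_imp_homeq[OF that(2)] that(1) unfolding I_def by blast
    have self: "y \<in> I +>\<^bsub>R\<^esub> y" if "y \<in> carrier R" for y
      using \<phi>.homeq_imp_rcos[OF that that refl] by (simp add: I_def)
    have sc: "scale r y \<in> carrier R" if "y \<in> carrier R" for y
      using that keys_scale[of r y] by (auto simp: carr)
    have Ic: "I \<subseteq> carrier R"
      unfolding I_def by (rule additive_subgroup.a_subset[OF \<phi>.additive_subgroup_a_kernel])
    have mem: "y \<in> carrier R" if "y \<in> X" for y
      using that \<phi>.R.a_r_coset_subset_G[OF Ic x(1)] unfolding x(2) by blast
    \<comment> \<open>Scalar multiplication of a coset is a union over its members. On that union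
      \<phi> is constant, because \<phi> is linear and members of one coset have the same
      image.\<close>
    have "\<phi> ` (\<Union>y\<in>X. I +>\<^bsub>R\<^esub> scale r y) = {scale r (\<phi> x)}"
    proof -
      have all: "\<phi> z = scale r (\<phi> x)" if "y \<in> X" "z \<in> I +>\<^bsub>R\<^esub> scale r y" for y z
        using coset[OF that(2) sc[OF mem[OF that(1)]]] coset[of y x] that(1) x
        by (simp add: \<phi>_def lext_scale)
      \<comment> \<open>The union is nonempty, so the constant value is attained and the image is a
        singleton rather than empty.\<close>
      have "scale r x \<in> (\<Union>y\<in>X. I +>\<^bsub>R\<^esub> scale r y)"
        using self[OF x(1)] self[OF sc[OF x(1)]] unfolding x(2) by blast
      then have "\<phi> (scale r x) \<in> \<phi> ` (\<Union>y\<in>X. I +>\<^bsub>R\<^esub> scale r y)" by (rule imageI)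
      then have "scale r (\<phi> x) \<in> \<phi> ` (\<Union>y\<in>X. I +>\<^bsub>R\<^esub> scale r y)"
        by (simp add: \<phi>_def lext_scale)
      with all show ?thesis by (intro equalityI subsetI) auto
    qed
    moreover have "h X = \<phi> x" unfolding h_def x(2) I_def by (rule \<phi>.the_elem_simp[OF x(1)])
    ultimately show ?thesis by (simp add: quotient_algebra_def smult h_def)
  qed
  moreover have "h \<in> ring_iso (quotient_algebra R I) S"
    using hom by (simp add: ring_iso_def ring_hom_def quotient_algebra_def)
  ultimately have "h \<in> algebra_iso (quotient_algebra R I) S" by (simp add: algebra_iso_def)
  then show ?thesis using \<phi>.kernel_is_ideal unfolding I_def by blast
qed

subsection \<open>Shifts and shuffles of set partitions\<close>

text \<open>The increasing bijection from \<open>{1..card S}\<close> to \<open>S\<close>; arguments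
  start at 1 and list positions at 0, hence \<open>x - 1\<close>.\<close>

definition emb :: "nat set \<Rightarrow> nat \<Rightarrow> nat" where
  "emb S x = sorted_list_of_set S ! (x - 1)"

text \<open>The values of \<open>f\<close> listed in order form a strictly sorted list of its image,
  and such a list is unique.\<close>

lemma emb_unique:
  assumes "strict_mono_on {1..n} f" "x \<in> {1..n}"
  shows "emb (f ` {1..n}) x = f x"
proof -
  have "sorted_list_of_set (f ` {1..n}) = map f [1..<Suc n]"
  proof (rule strict_sorted_equal)
    show "sorted_wrt (<) (map f [1..<Suc n])"
      using assms(1) by (auto simp: sorted_wrt_iff_nth_less strict_mono_on_def simp del: upt_Suc)
  qed (auto simp: atLeastLessThanSuc_atLeastAtMost)
  then show ?thesis using assms(2) by (auto simp: emb_def simp del: upt_Suc)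
qed

lemma emb_image:
  assumes "finite S"
  shows "emb S ` {1..card S} = S"
proof -
  have "emb S ` {1..card S} = (!) (sorted_list_of_set S) ` {..<card S}"
    unfolding image_Suc_lessThan[symmetric] image_image emb_def by simp
  also have "\<dots> = set (sorted_list_of_set S)"
    by (auto simp: set_conv_nth)
  finally show ?thesis using assms by simp
qed

lemma strict_mono_emb: "strict_mono_on {1..card S} (emb S)"
  by (auto simp: strict_mono_on_def emb_def intro!: sorted_wrt_nth_less[of "(<)"])

lemma bij_betw_emb: "finite S \<Longrightarrow> bij_betw (emb S) {1..card S} S"
  using emb_image strict_mono_emb by (metis bij_betw_def strict_mono_on_imp_inj_on)

lemma emb_atLeastAtMost: "x \<in> {1..n} \<Longrightarrow> emb {1..n} x = x"
  using emb_unique[of n id x] by (simp add: strict_mono_on_def)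

text \<open>The composite of two increasing enumerations is strictly increasing, so by
  \<open>emb_unique\<close> it enumerates its own image.\<close>

lemma emb_emb:
  assumes "finite T" "S \<subseteq> {1..card T}" "x \<in> {1..card S}"
  shows "emb T (emb S x) = emb (emb T ` S) x"
proof -
  have S: "emb S ` {1..card S} = S" using assms finite_subset by (intro emb_image) blast
  have "strict_mono_on {1..card S} (emb T \<circ> emb S)"
    using strict_mono_emb[of T] strict_mono_emb[of S] S assms(2)
    unfolding strict_mono_on_def comp_def by (metis image_eqI subsetD)
  from emb_unique[OF this assms(3)] show ?thesis
    by (simp only: S image_comp[symmetric] comp_apply)
qed

text \<open>In a partition of \<open>{1..n}\<close> exactly \<open>x - 1\<close> elements lie below
  \<open>x\<close>, so the rank used by \<open>shift\<close> is the list position used by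
  \<open>emb\<close>.\<close>

lemma shift_eq_emb:
  assumes "\<pi> \<in> set_partitions_of n"
  shows "shift S \<pi> = (`) (emb S) ` \<pi>"
proof -
  have U: "\<Union>\<pi> = {1..n}" using assms by (simp add: set_partitions_of_def partition_on_def)
  have c: "card {y \<in> \<Union>\<pi>. y < x} = x - 1" if "x \<in> \<Union>\<pi>" for x
  proof -
    have "{y \<in> \<Union>\<pi>. y < x} = {1..<x}" using that unfolding U by auto
    then show ?thesis by simp
  qed
  show ?thesis
    unfolding shift_def emb_def by (intro image_cong refl) (metis UnionI c)
qed

lemma shift_atLeastAtMost:
  assumes "\<pi> \<in> set_partitions_of n"
  shows "shift {1..n} \<pi> = \<pi>"
proof -
  have "emb {1..n} ` B = B" if "B \<in> \<pi>" for B
  proof -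
    have "B \<subseteq> {1..n}"
      using assms that by (auto simp: set_partitions_of_def partition_on_def)
    then have "emb {1..n} ` B = id ` B"
      by (intro image_cong refl) (simp only: id_apply emb_atLeastAtMost subsetD)
    then show ?thesis by simp
  qed
  then show ?thesis by (simp add: shift_eq_emb[OF assms])
qed

text \<open>This is \<open>emb_emb\<close> applied block by block. It collapses the two successive
  renamings of an iterated shuffle into a single shift.\<close>

lemma image_emb_shift:
  assumes "\<pi> \<in> set_partitions_of n" "finite T" "S \<subseteq> {1..card T}" "card S = n"
  shows "(`) (emb T) ` shift S \<pi> = shift (emb T ` S) \<pi>"
proof -
  have "emb T ` emb S ` B = emb (emb T ` S) ` B" if "B \<in> \<pi>" for B
  proof -
    have "B \<subseteq> {1..n}"
      using assms(1) that by (auto simp: set_partitions_of_def partition_on_def)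
    then show ?thesis
      using assms emb_emb[OF assms(2,3)] by (auto simp: image_image subset_iff intro!: image_cong)
  qed
  then show ?thesis by (simp add: shift_eq_emb[OF assms(1)] image_image)
qed

lemma partition_on_shift:
  assumes "\<pi> \<in> set_partitions_of n" "finite S" "card S = n"
  shows "partition_on S (shift S \<pi>)"
proof -
  have "partition_on {1..n} \<pi>" using assms(1) by (simp add: set_partitions_of_def)
  from partition_on_inj_image[OF this, of "emb S"] bij_betw_emb[OF assms(2)]
  have "partition_on S ((`) (emb S) ` \<pi> - {{}})"
    by (simp add: assms(3) bij_betw_def)
  \<comment> \<open>The library result on images discards an empty block; none arises, since the
    blocks of \<pi> are nonempty.\<close>
  moreover have "{} \<notin> (`) (emb S) ` \<pi>"
    using assms(1) by (auto simp: set_partitions_of_def partition_on_def)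
  ultimately show ?thesis by (simp add: shift_eq_emb[OF assms(1)])
qed

lemma partition_on_Un:
  assumes "partition_on A P" "partition_on B Q" "A \<inter> B = {}"
  shows "partition_on (A \<union> B) (P \<union> Q)"
  using assms by (auto simp: partition_on_def intro!: disjoint_union)

lemma shuffle_in_set_partitions_of:
  assumes "\<tau> \<in> set_partitions_of n" "\<theta> \<in> set_partitions_of m" "S \<subseteq> {1..n + m}" "card S = n"
  shows "shift S \<tau> \<union> shift ({1..n + m} - S) \<theta> \<in> set_partitions_of (n + m)"
proof -
  have f: "finite S" using assms(3) finite_subset by blast
  have "card ({1..n + m} - S) = m" using assms f by (simp add: card_Diff_subset)
  then have "partition_on (S \<union> ({1..n + m} - S)) (shift S \<tau> \<union> shift ({1..n + m} - S) \<theta>)"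
    using assms f by (intro partition_on_Un partition_on_shift) auto
  then show ?thesis using assms(3) by (simp add: set_partitions_of_def Un_absorb1)
qed

section \<open>Shuffles as sums over subsets\<close>

text \<open>Writing the multiset as a sum of singletons turns associativity into an identity of
  nested finite sums.\<close>

lemma arc_shuffle_eq_sum:
  assumes "\<tau> \<in> set_partitions_of n" "\<theta> \<in> set_partitions_of m"
  shows "arc_shuffle \<tau> \<theta> =
    (\<Sum>S | S \<subseteq> {1..n + m} \<and> card S = n. {#shift S \<tau> \<union> shift ({1..n + m} - S) \<theta>#})"
  by (simp add: arc_shuffle_def Let_def psize_set_partitions_of[OF assms(1)]
      psize_set_partitions_of[OF assms(2)] sum_unfold_sum_mset)

lemma sum_mset_arc_shuffle:
  assumes "\<tau> \<in> set_partitions_of n" "\<theta> \<in> set_partitions_of m"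
  shows "(\<Sum>\<pi>\<in>#arc_shuffle \<tau> \<theta>. G \<pi>) =
    (\<Sum>S | S \<subseteq> {1..n + m} \<and> card S = n. G (shift S \<tau> \<union> shift ({1..n + m} - S) \<theta>))"
  by (simp add: arc_shuffle_def Let_def psize_set_partitions_of[OF assms(1)]
      psize_set_partitions_of[OF assms(2)] sum_unfold_sum_mset image_mset.compositionality comp_def)

lemma arc_shuffle_closed:
  assumes "\<tau> \<in> set_partitions_of n" "\<theta> \<in> set_partitions_of m" "\<pi> \<in># arc_shuffle \<tau> \<theta>"
  shows "\<pi> \<in> set_partitions_of (n + m)"
proof -
  \<comment> \<open>Membership in \<open>mset_set\<close> yields an index set \<open>S\<close> only
    when the family of index sets is finite.\<close>
  have "finite {S. S \<subseteq> {1..n + m} \<and> card S = n}"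
    by (rule finite_subset[of _ "Pow {1..n + m}"]) auto
  with assms(3) obtain S where "S \<subseteq> {1..n + m}" "card S = n"
    "\<pi> = shift S \<tau> \<union> shift ({1..n + m} - S) \<theta>"
    by (auto simp: arc_shuffle_def psize_set_partitions_of[OF assms(1)]
        psize_set_partitions_of[OF assms(2)])
  then show ?thesis using shuffle_in_set_partitions_of[OF assms(1,2)] by simp
qed

text \<open>Taking images under the bijection \<open>emb T\<close> matches the
  \<open>n\<close>-subsets of \<open>{1..card T}\<close> with those of \<open>T\<close>, and
  injectivity sends complements to complements.\<close>

lemma sum_emb_image:
  assumes "finite T"
  shows "(\<Sum>S | S \<subseteq> {1..card T} \<and> card S = n. g (emb T ` S) (emb T ` ({1..card T} - S))) =
    (\<Sum>A | A \<subseteq> T \<and> card A = n. g A (T - A))"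
proof -
  let ?f = "emb T" and ?X = "{1..card T}"
  have b: "inj_on ?f ?X" "?f ` ?X = T" using bij_betw_emb[OF assms] by (auto simp: bij_betw_def)
  have c: "card (?f ` S) = card S" if "S \<subseteq> ?X" for S
    using card_image[OF inj_on_subset[OF b(1) that]] .
  have "inj_on ((`) ?f) {S. S \<subseteq> ?X \<and> card S = n}"
    by (rule inj_on_subset[OF inj_on_image_Pow[OF b(1)]]) blast
  moreover have "(`) ?f ` {S. S \<subseteq> ?X \<and> card S = n} = {A. A \<subseteq> T \<and> card A = n}"
  proof (intro equalityI subsetI)
    fix A assume "A \<in> (`) ?f ` {S. S \<subseteq> ?X \<and> card S = n}"
    then obtain S where "S \<subseteq> ?X" "card S = n" "A = ?f ` S" by blast
    then show "A \<in> {A. A \<subseteq> T \<and> card A = n}"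
      using c[of S] image_mono[of S ?X ?f] by (simp only: b(2) mem_Collect_eq)
  next
    fix A assume A: "A \<in> {A. A \<subseteq> T \<and> card A = n}"
    then have "A \<subseteq> ?f ` ?X" unfolding b(2) by simp
    then obtain S where S: "S \<subseteq> ?X" "A = ?f ` S" by (rule subset_imageE)
    then have "card S = n" using A c[OF S(1)] by (simp only: mem_Collect_eq)
    with S show "A \<in> (`) ?f ` {S. S \<subseteq> ?X \<and> card S = n}" by (intro image_eqI[of _ _ S] CollectI conjI)
  qed
  ultimately have "bij_betw ((`) ?f) {S. S \<subseteq> ?X \<and> card S = n} {A. A \<subseteq> T \<and> card A = n}"
    unfolding bij_betw_def by (rule conjI)
  then have "(\<Sum>A | A \<subseteq> T \<and> card A = n. g A (T - A)) =
      (\<Sum>S | S \<subseteq> ?X \<and> card S = n. g (?f ` S) (T - ?f ` S))"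
    by (rule sum.reindex_bij_betw[symmetric])
  also have "\<dots> = (\<Sum>S | S \<subseteq> ?X \<and> card S = n. g (?f ` S) (?f ` (?X - S)))"
  proof (rule sum.cong[OF refl])
    fix S assume "S \<in> {S. S \<subseteq> ?X \<and> card S = n}"
    then have "?f ` (?X - S) = T - ?f ` S"
      using inj_on_image_set_diff[OF b(1), of ?X S] unfolding b(2) by blast
    then show "g (?f ` S) (T - ?f ` S) = g (?f ` S) (?f ` (?X - S))" by simp
  qed
  finally show ?thesis by simp
qed

text \<open>Both sides run over the ordered decompositions of \<open>N\<close> into
  \<open>A\<close>, \<open>B\<close> and a remainder, with \<open>A\<close> and \<open>B\<close> of
  sizes \<open>n\<close> and \<open>m\<close>. The left side picks the union \<open>T\<close> of
  \<open>A\<close> and \<open>B\<close> first, the right side picks \<open>A\<close> first.\<close>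

lemma sum_nested_subsets:
  fixes F :: "'a set \<Rightarrow> 'a set \<Rightarrow> 'a set \<Rightarrow> 'c::comm_monoid_add"
  assumes "finite N"
  shows "(\<Sum>T | T \<subseteq> N \<and> card T = n + m. \<Sum>A | A \<subseteq> T \<and> card A = n. F A (T - A) (N - T)) =
    (\<Sum>A | A \<subseteq> N \<and> card A = n. \<Sum>B | B \<subseteq> N - A \<and> card B = m. F A B (N - A - B))"
proof -
  have f: "finite {A. A \<subseteq> T \<and> card A = r}" if "T \<subseteq> N" for T r
    by (rule finite_subset[of _ "Pow N"]) (use that assms in auto)
  let ?D = "SIGMA T:{T. T \<subseteq> N \<and> card T = n + m}. {A. A \<subseteq> T \<and> card A = n}"
  let ?E = "SIGMA A:{A. A \<subseteq> N \<and> card A = n}. {B. B \<subseteq> N - A \<and> card B = m}"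
  have "(\<Sum>T | T \<subseteq> N \<and> card T = n + m. \<Sum>A | A \<subseteq> T \<and> card A = n. F A (T - A) (N - T)) =
      (\<Sum>(T, A)\<in>?D. F A (T - A) (N - T))"
    by (intro sum.Sigma ballI f order_refl) blast
  also have "\<dots> = (\<Sum>(A, B)\<in>?E. F A B (N - A - B))"
  proof (rule sum.reindex_bij_witness[where i = "\<lambda>(A, B). (A \<union> B, A)" and j = "\<lambda>(T, A). (A, T - A)"])
    fix x assume "x \<in> ?D"
    then obtain T A where x: "x = (T, A)" "A \<subseteq> T" "T \<subseteq> N" "card T = n + m" "card A = n" by auto
    have fA: "finite A" using finite_subset[OF x(2) finite_subset[OF x(3) assms]] .
    have "card (T - A) = m" using card_Diff_subset[OF fA x(2)] x(4,5) by simp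
    then show "(case x of (T, A) \<Rightarrow> (A, T - A)) \<in> ?E" using x by auto
    show "(case case x of (T, A) \<Rightarrow> (A, T - A) of (A, B) \<Rightarrow> (A \<union> B, A)) = x"
      using x(2) by (simp add: x(1) Un_absorb1)
    have "N - A - (T - A) = N - T" using x(2) by blast
    then show "(case case x of (T, A) \<Rightarrow> (A, T - A) of (A, B) \<Rightarrow> F A B (N - A - B)) =
        (case x of (T, A) \<Rightarrow> F A (T - A) (N - T))" using x by simp
  next
    fix y assume "y \<in> ?E"
    then obtain A B where y: "y = (A, B)" "A \<subseteq> N" "B \<subseteq> N - A" "card A = n" "card B = m" by auto
    have "finite A" "finite B"
      using finite_subset[OF y(2) assms] finite_subset[OF y(3) finite_Diff[OF assms]] .
    moreover have "A \<inter> B = {}" using y(3) by blast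
    ultimately have "card (A \<union> B) = n + m" using y(4,5) by (simp add: card_Un_disjoint)
    then show "(case y of (A, B) \<Rightarrow> (A \<union> B, A)) \<in> ?D" using y by auto
    have "A \<union> B - A = B" using y(3) by blast
    then show "(case case y of (A, B) \<Rightarrow> (A \<union> B, A) of (T, A) \<Rightarrow> (A, T - A)) = y" using y by simp
  qed
  also have "\<dots> = (\<Sum>A | A \<subseteq> N \<and> card A = n. \<Sum>B | B \<subseteq> N - A \<and> card B = m. F A B (N - A - B))"
    by (intro sum.Sigma[symmetric] ballI f order_refl) blast
  finally show ?thesis .
qed

section \<open>Associativity and unit of the shuffle\<close>

text \<open>The set \<open>S\<close> of the inner shuffle records a relative position: that of
  \<open>A\<close> inside \<open>T\<close> on the left, that of \<open>B\<close> inside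
  \<open>N - A\<close> on the right. Applying \<open>emb\<close> converts it to an absolute
  position, after which \<open>sum_nested_subsets\<close> matches the two sides.\<close>

lemma arc_shuffle_assoc:
  assumes "\<tau> \<in> set_partitions_of n" "\<theta> \<in> set_partitions_of m" "\<rho> \<in> set_partitions_of k"
  shows "(\<Sum>\<pi>\<in>#arc_shuffle \<tau> \<theta>. arc_shuffle \<pi> \<rho>) = (\<Sum>\<pi>\<in>#arc_shuffle \<theta> \<rho>. arc_shuffle \<tau> \<pi>)"
proof -
  define N where "N = {1..n + m + k}"
  define F where "F A B C = {#shift A \<tau> \<union> shift B \<theta> \<union> shift C \<rho>#}" for A B C
  have sub: "card ({1..a + b} - S) = b" if "S \<subseteq> {1..a + b}" "card S = a" for S and a b :: nat
    using that by (subst card_Diff_subset) (auto intro: finite_subset)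
  \<comment> \<open>A shuffle is itself a set partition of \<open>{1..a + b}\<close>, so shifting it
    is an image under \<open>emb T\<close>, which distributes over the union.\<close>
  have shift_shuffle: "shift T (shift S \<sigma> \<union> shift ({1..a + b} - S) \<sigma>') =
      shift (emb T ` S) \<sigma> \<union> shift (emb T ` ({1..a + b} - S)) \<sigma>'"
    if "\<sigma> \<in> set_partitions_of a" "\<sigma>' \<in> set_partitions_of b" "finite T" "card T = a + b"
      "S \<subseteq> {1..a + b}" "card S = a" for \<sigma> \<sigma>' T S and a b :: nat
    using that shift_eq_emb[OF shuffle_in_set_partitions_of[OF that(1,2,5,6)], of T] sub[OF that(5,6)]
    by (simp add: image_Un image_emb_shift)
  have "(\<Sum>\<pi>\<in>#arc_shuffle \<tau> \<theta>. arc_shuffle \<pi> \<rho>) =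
      (\<Sum>S | S \<subseteq> {1..n + m} \<and> card S = n. \<Sum>T | T \<subseteq> N \<and> card T = n + m.
        F (emb T ` S) (emb T ` ({1..n + m} - S)) (N - T))"
    unfolding sum_mset_arc_shuffle[OF assms(1,2)]
  proof (rule sum.cong[OF refl])
    fix S assume "S \<in> {S. S \<subseteq> {1..n + m} \<and> card S = n}"
    then have S: "S \<subseteq> {1..n + m}" "card S = n" by auto
    show "arc_shuffle (shift S \<tau> \<union> shift ({1..n + m} - S) \<theta>) \<rho> = (\<Sum>T | T \<subseteq> N \<and> card T = n + m.
        F (emb T ` S) (emb T ` ({1..n + m} - S)) (N - T))"
      unfolding arc_shuffle_eq_sum[OF shuffle_in_set_partitions_of[OF assms(1,2) S] assms(3)]
        F_def N_def
    proof (intro sum.cong refl)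
      fix T assume "T \<in> {T. T \<subseteq> {1..n + m + k} \<and> card T = n + m}"
      then have "finite T" "card T = n + m" by (auto intro: finite_subset[OF _ finite_atLeastAtMost])
      then show "{#shift T (shift S \<tau> \<union> shift ({1..n + m} - S) \<theta>) \<union> shift ({1..n + m + k} - T) \<rho>#} =
          {#shift (emb T ` S) \<tau> \<union> shift (emb T ` ({1..n + m} - S)) \<theta> \<union> shift ({1..n + m + k} - T) \<rho>#}"
        using S by (simp only: shift_shuffle[OF assms(1,2)])
    qed
  qed
  \<comment> \<open>With \<open>T\<close> outermost and fixed, the sum over \<open>S\<close> can be
    reindexed by subsets of \<open>T\<close>.\<close>
  also have "\<dots> = (\<Sum>T | T \<subseteq> N \<and> card T = n + m. \<Sum>S | S \<subseteq> {1..n + m} \<and> card S = n.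
        F (emb T ` S) (emb T ` ({1..n + m} - S)) (N - T))"
    by (rule sum.swap)
  also have "\<dots> = (\<Sum>T | T \<subseteq> N \<and> card T = n + m. \<Sum>A | A \<subseteq> T \<and> card A = n. F A (T - A) (N - T))"
  proof (rule sum.cong[OF refl])
    fix T assume "T \<in> {T. T \<subseteq> N \<and> card T = n + m}"
    then have "finite T" "card T = n + m" 
      by (auto simp: N_def intro: finite_subset[OF _ finite_atLeastAtMost])
    then show "(\<Sum>S | S \<subseteq> {1..n + m} \<and> card S = n.
        F (emb T ` S) (emb T ` ({1..n + m} - S)) (N - T)) =
      (\<Sum>A | A \<subseteq> T \<and> card A = n. F A (T - A) (N - T))"
      using sum_emb_image[of T "\<lambda>A B. F A B (N - T)" n] by simp
  qed
  also have "\<dots> = (\<Sum>A | A \<subseteq> N \<and> card A = n. \<Sum>B | B \<subseteq> N - A \<and> card B = m. F A B (N - A - B))"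
    by (rule sum_nested_subsets) (simp add: N_def)
  also have "\<dots> = (\<Sum>A | A \<subseteq> N \<and> card A = n. \<Sum>S | S \<subseteq> {1..m + k} \<and> card S = m.
        F A (emb (N - A) ` S) (emb (N - A) ` ({1..m + k} - S)))"
  proof (rule sum.cong[OF refl])
    fix A assume "A \<in> {A. A \<subseteq> N \<and> card A = n}"
    then have "finite (N - A)" "card (N - A) = m + k"
      using sub[of A n "m + k"] by (auto simp: N_def add.assoc)
    then show "(\<Sum>B | B \<subseteq> N - A \<and> card B = m. F A B (N - A - B)) =
      (\<Sum>S | S \<subseteq> {1..m + k} \<and> card S = m.
        F A (emb (N - A) ` S) (emb (N - A) ` ({1..m + k} - S)))"
      using sum_emb_image[of "N - A" "F A" m] by simp
  qed
  also have "\<dots> = (\<Sum>S | S \<subseteq> {1..m + k} \<and> card S = m. \<Sum>A | A \<subseteq> N \<and> card A = n.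
        F A (emb (N - A) ` S) (emb (N - A) ` ({1..m + k} - S)))"
    by (rule sum.swap)
  also have "\<dots> = (\<Sum>\<pi>\<in>#arc_shuffle \<theta> \<rho>. arc_shuffle \<tau> \<pi>)"
    unfolding sum_mset_arc_shuffle[OF assms(2,3)]
  proof (rule sum.cong[OF refl])
    fix S assume "S \<in> {S. S \<subseteq> {1..m + k} \<and> card S = m}"
    then have S: "S \<subseteq> {1..m + k}" "card S = m" by auto
    show "(\<Sum>A | A \<subseteq> N \<and> card A = n. F A (emb (N - A) ` S) (emb (N - A) ` ({1..m + k} - S))) =
        arc_shuffle \<tau> (shift S \<theta> \<union> shift ({1..m + k} - S) \<rho>)"
      \<comment> \<open>The ground set was bracketed as \<open>n + m + k\<close>, whereas shuffling
        \<tau> with a partition of size \<open>m + k\<close> produces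
        \<open>n + (m + k)\<close>.\<close>
      unfolding arc_shuffle_eq_sum[OF assms(1) shuffle_in_set_partitions_of[OF assms(2,3) S]]
        F_def N_def add.assoc
    proof (intro sum.cong refl)
      fix A assume "A \<in> {A. A \<subseteq> {1..n + (m + k)} \<and> card A = n}"
      then have "finite ({1..n + (m + k)} - A)" "card ({1..n + (m + k)} - A) = m + k"
        using sub[of A n "m + k"] by auto
      then show "{#shift A \<tau> \<union> shift (emb ({1..n + (m + k)} - A) ` S) \<theta> \<union>
            shift (emb ({1..n + (m + k)} - A) ` ({1..m + k} - S)) \<rho>#} =
          {#shift A \<tau> \<union> shift ({1..n + (m + k)} - A) (shift S \<theta> \<union> shift ({1..m + k} - S) \<rho>)#}"
        using S by (simp only: shift_shuffle[OF assms(2,3)] Un_assoc)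
    qed
  qed
  finally show ?thesis .
qed

lemma set_partitions_of_0: "set_partitions_of 0 = {{}}"
  by (auto simp: set_partitions_of_def partition_on_empty)

text \<open>A single position set is available, the empty set or all of \<open>{1..n}\<close>, and
  shifting \<pi> to the full interval changes nothing.\<close>

lemma arc_shuffle_empty:
  assumes "\<pi> \<in> set_partitions_of n"
  shows "arc_shuffle {} \<pi> = {#\<pi>#}" "arc_shuffle \<pi> {} = {#\<pi>#}"
proof -
  have e: "{} \<in> set_partitions_of 0" by (simp add: set_partitions_of_0)
  have "{S. S \<subseteq> {1..n} \<and> card S = 0} = {{}}"
    by (auto dest: finite_subset[OF _ finite_atLeastAtMost])
  then show "arc_shuffle {} \<pi> = {#\<pi>#}"
    using arc_shuffle_eq_sum[OF e assms] by (simp add: shift_atLeastAtMost[OF assms, simplified] shift_def[of _ "{}"])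
  have "{S. S \<subseteq> {1..n} \<and> card S = n} = {{1..n}}"
    using card_subset_eq[of "{1..n}"] by auto
  then show "arc_shuffle \<pi> {} = {#\<pi>#}"
    using arc_shuffle_eq_sum[OF assms e] by (simp add: shift_atLeastAtMost[OF assms, simplified] shift_def[of _ "{}"])
qed

lemma basis_monoid_arc_shuffle: "basis_monoid set_partitions {} arc_shuffle"
proof
  show "{} \<in> set_partitions"
    unfolding set_partitions_def by (rule UN_I[of 0]) (simp_all add: set_partitions_of_0)
next
  fix a b assume "a \<in> set_partitions" "b \<in> set_partitions"
  then obtain n m where "a \<in> set_partitions_of n" "b \<in> set_partitions_of m"
    unfolding set_partitions_def by blast
  from arc_shuffle_closed[OF this] show "set_mset (arc_shuffle a b) \<subseteq> set_partitions"
    unfolding set_partitions_def by (intro subsetI UN_I[OF UNIV_I])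
next
  fix a assume "a \<in> set_partitions"
  then obtain n where "a \<in> set_partitions_of n"
    unfolding set_partitions_def by blast
  then show "arc_shuffle {} a = {#a#}" "arc_shuffle a {} = {#a#}"
    by (rule arc_shuffle_empty)+
next
  fix a b c assume "a \<in> set_partitions" "b \<in> set_partitions" "c \<in> set_partitions"
  then obtain n m k where
    "a \<in> set_partitions_of n" "b \<in> set_partitions_of m" "c \<in> set_partitions_of k"
    unfolding set_partitions_def by blast
  then show "(\<Sum>d\<in>#arc_shuffle a b. arc_shuffle d c) = (\<Sum>d\<in>#arc_shuffle b c. arc_shuffle a d)"
    by (rule arc_shuffle_assoc)
qed

section \<open>The quotient by classes of a statistic\<close>

theorem proposition5p3:
  fixes st :: "set_partition \<Rightarrow> 's"
  assumes "weakly_shuffle_compatible st"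
  shows "\<exists>I. ideal I NCSym_dual \<and>
    (\<exists>h. h \<in> algebra_iso (quotient_algebra NCSym_dual I) (shuffle_algebra st))"
  unfolding NCSym_dual_def shuffle_algebra_def
\<comment> \<open>Sending \<pi> to its class maps the basis of one algebra onto that of the other
  and unit to unit. What remains is that products of classes do not depend on the chosen
  representatives.\<close>
proof (rule basis_algebra_quotient[where q = "st_class st", OF basis_monoid_arc_shuffle])
  have some: "(SOME \<sigma>. \<sigma> \<in> st_class st \<pi>) \<in> st_class st \<pi>" if "\<pi> \<in> set_partitions" for \<pi>
    using that by (intro someI[of "\<lambda>\<sigma>. \<sigma> \<in> st_class st \<pi>" \<pi>]) (simp add: st_class_def)
  fix \<tau> \<theta> assume "\<tau> \<in> set_partitions" "\<theta> \<in> set_partitions"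
  then show "image_mset (st_class st)
      (arc_shuffle (SOME \<sigma>. \<sigma> \<in> st_class st \<tau>) (SOME \<sigma>. \<sigma> \<in> st_class st \<theta>)) =
    image_mset (st_class st) (arc_shuffle \<tau> \<theta>)"
    \<comment> \<open>Weak shuffle-compatibility enters here: replacing \<tau> and \<theta> by the
      chosen members of their classes preserves the multiset of classes in the shuffle.\<close>
    by (intro image_st_class_arc_shuffle_cong assms some)
qed

end
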